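(* Let $X\in\mathbb R^{n\times p}$, $Y\in\mathbb R^{n\times T}$, $\lambda>0$, let $\hat B$ be the multi-task Lasso estimator, $\hat S$ its set of nonzero rows, and $\hat A\in\mathbb R^{T\times T}$ its interaction matrix (as defined in the context). Then: (i) $\hat A$ is symmetric and positive semi-definite. (ii) If $X_{\hat S}$ has rank $|\hat S|$ then $\|\hat A\|_{op}\le|\hat S|$. (iii) If $X_{\hat S}$ has rank $|\hat S|$ and $|\hat S|/n<1$ then $I_{T\times T}-\hat A/n$ is positive-definite and $$\|I_{T\times T}-(I_{T\times T}-\hat A/n)^{-1}\|_{op}\le\frac{|\hat S|/n}{1-|\hat S|/n}.$$
   Context: Notation: $e_j$ denotes canonical basis vectors, $\|\cdot\|_F$ the Frobenius norm, $\|\cdot\|_{op}$ the spectral norm, $\|B\|_{2,1}=\sum_{j=1}^p\|B^\top e_j\|_2$ for $B\in\mathbb R^{p\times T}$, $\otimes$ the Kronecker product, $\dagger$ the Moore–Penrose inverse. Multi-task Lasso: $\hat B=\operatorname{argmin}_{B\in\mathbb R^{p\times T}}\big(\frac1{2nT}\|Y-XB\|_F^2+\lambda\|B\|_{2,1}\big)$. Interaction matrix: let $\hat S=\{j\in\{1,\dots,p\}:\hat B^\top e_j\ne0\}$; let $X_{\hat S}\in\mathbb R^{n\times p}$ be $X$ with the columns not indexed by $\hat S$ replaced by zero; $\tilde X=I_{T\times T}\otimes X_{\hat S}$; for $j\in\hat S$, $H^{(j)}=\lambda\|\hat B^\top e_j\|_2^{-1}\big(I_{T\times T}-\hat B^\top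 e_je_j^\top\hat B\,\|\hat B^\top e_j\|_2^{-2}\big)\in\mathbb R^{T\times T}$; $\tilde H=\sum_{j\in\hat S}H^{(j)}\otimes(e_je_j^\top)\in\mathbb R^{pT\times pT}$. The matrix $\hat A\in\mathbb R^{T\times T}$ has entries $\hat A_{tt'}=\operatorname{Tr}\big[(e_t^\top\otimes X_{\hat S})(\tilde X^\top\tilde X+nT\tilde H)^\dagger(e_{t'}\otimes X_{\hat S}^\top)\big]$. *)

theory Defs
  imports "HOL-Analysis.Analysis"
begin

text \<open>
  A matrix with \<open>m\<close> rows and \<open>k\<close> columns has type \<open>real ^ 'k ^ 'm\<close>.  On this type the library's
  \<open>norm\<close> is the Euclidean norm of the Euclidean row norms, that is, the Frobenius norm.
\<close>

text \<open>Rows and columns of a Kronecker product are indexed by pairs, the index of the left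
  factor being the major (block) one.\<close>

definition kron :: "real ^ 'b ^ 'a \<Rightarrow> real ^ 'd ^ 'c \<Rightarrow> real ^ ('b \<times> 'd) ^ ('a \<times> 'c)"
  (infixl \<open>\<otimes>\<^sub>K\<close> 75) where
  "A \<otimes>\<^sub>K B = (\<chi> i j. A $ fst i $ fst j * B $ snd i $ snd j)"

definition is_moore_penrose :: "real ^ 'k ^ 'm \<Rightarrow> real ^ 'm ^ 'k \<Rightarrow> bool" where
  "is_moore_penrose A G \<longleftrightarrow>
     A ** G ** A = A \<and> G ** A ** G = G \<and>
     transpose (A ** G) = A ** G \<and> transpose (G ** A) = G ** A"

text \<open>Every real matrix has exactly one matrix satisfying the four Penrose equations, so the
  description below always denotes.\<close>

definition moore_penrose :: "real ^ 'k ^ 'm \<Rightarrow> real ^ 'm ^ 'k" where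
  "moore_penrose A = (THE G. is_moore_penrose A G)"

definition op_norm :: "real ^ 'k ^ 'm \<Rightarrow> real" where
  "op_norm A = onorm (\<lambda>v. A *v v)"

definition symmetric_matrix :: "real ^ 'm ^ 'm \<Rightarrow> bool" where
  "symmetric_matrix A \<longleftrightarrow> transpose A = A"

definition positive_semidefinite :: "real ^ 'm ^ 'm \<Rightarrow> bool" where
  "positive_semidefinite A \<longleftrightarrow> symmetric_matrix A \<and> (\<forall>v. 0 \<le> v \<bullet> (A *v v))"

definition positive_definite :: "real ^ 'm ^ 'm \<Rightarrow> bool" where
  "positive_definite A \<longleftrightarrow> symmetric_matrix A \<and> (\<forall>v. v \<noteq> 0 \<longrightarrow> 0 < v \<bullet> (A *v v))"

definition norm21 :: "real ^ 't ^ 'p \<Rightarrow> real" where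
  "norm21 B = (\<Sum>j\<in>UNIV. norm (transpose B *v axis j 1))"

definition mtl_objective ::
  "real ^ 'p ^ 'n \<Rightarrow> real ^ 't ^ 'n \<Rightarrow> real \<Rightarrow> real ^ 't ^ 'p \<Rightarrow> real" where
  "mtl_objective X Y lam B =
     1 / (2 * real CARD('n) * real CARD('t)) * (norm (Y - X ** B))\<^sup>2 + lam * norm21 B"

text \<open>The minimiser need not be unique; the estimator is any minimiser over all matrices.\<close>

definition is_mtl_estimator ::
  "real ^ 'p ^ 'n \<Rightarrow> real ^ 't ^ 'n \<Rightarrow> real \<Rightarrow> real ^ 't ^ 'p \<Rightarrow> bool" where
  "is_mtl_estimator X Y lam B \<longleftrightarrow> is_arg_min (mtl_objective X Y lam) (\<lambda>_. True) B"

definition row_support :: "real ^ 't ^ 'p \<Rightarrow> 'p set" where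
  "row_support B = {j. transpose B *v axis j 1 \<noteq> 0}"

definition restrict_columns :: "real ^ 'p ^ 'n \<Rightarrow> 'p set \<Rightarrow> real ^ 'p ^ 'n" where
  "restrict_columns X S = (\<chi> i j. if j \<in> S then X $ i $ j else 0)"

definition X_tilde :: "real ^ 'p ^ 'n \<Rightarrow> real ^ 't ^ 'p \<Rightarrow> real ^ ('t \<times> 'p) ^ ('t \<times> 'n)" where
  "X_tilde X B = (mat 1 :: real ^ 't ^ 't) \<otimes>\<^sub>K restrict_columns X (row_support B)"

text \<open>For column vectors \<open>u\<close> and \<open>v\<close>, the matrix \<open>u v\<^sup>T\<close>; the intermediate dimension is 1.\<close>

definition outer :: "real ^ 'm \<Rightarrow> real ^ 'k \<Rightarrow> real ^ 'k ^ 'm" where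
  "outer u v = (columnvector u :: real ^ 1 ^ 'm) ** (rowvector v :: real ^ 'k ^ 1)"

definition H_row :: "real \<Rightarrow> real ^ 't ^ 'p \<Rightarrow> 'p \<Rightarrow> real ^ 't ^ 't" where
  "H_row lam B j =
     (lam * inverse (norm (transpose B *v axis j 1))) *\<^sub>R
       (mat 1 - inverse ((norm (transpose B *v axis j 1))\<^sup>2) *\<^sub>R
          (transpose B ** outer (axis j 1) (axis j 1) ** B))"

definition H_tilde :: "real \<Rightarrow> real ^ 't ^ 'p \<Rightarrow> real ^ ('t \<times> 'p) ^ ('t \<times> 'p)" where
  "H_tilde lam B = (\<Sum>j\<in>row_support B. H_row lam B j \<otimes>\<^sub>K outer (axis j 1) (axis j 1))"

definition interaction_matrix ::
  "real ^ 'p ^ 'n \<Rightarrow> real \<Rightarrow> real ^ 't ^ 'p \<Rightarrow> real ^ 't ^ 't" where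
  "interaction_matrix X lam B = (\<chi> t t'.
     let XS = restrict_columns X (row_support B);
         M = transpose (X_tilde X B) ** X_tilde X B +
             (real CARD('n) * real CARD('t)) *\<^sub>R H_tilde lam B
     in trace (((rowvector (axis t 1) :: real ^ 't ^ 1) \<otimes>\<^sub>K XS) ** moore_penrose M **
               ((columnvector (axis t' 1) :: real ^ 1 ^ 't) \<otimes>\<^sub>K transpose XS)))"

end

theory Submission
  imports Defs
begin

text \<open>
  Write \<open>G\<close> for the pseudoinverse of \<open>W\<^sup>T W + nT H\<close> with \<open>W = I \<otimes> X\<^sub>S\<close>.  Then \<open>v\<^sup>T A v\<close> is the trace of
  \<open>(v \<otimes> I)\<^sup>T W G W\<^sup>T (v \<otimes> I)\<close>, and \<open>0 \<le> W G W\<^sup>T \<le> I\<close> because \<open>H\<close> is positive semidefinite.  The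
  matrix under the trace is thus at most \<open>|v|\<^sup>2 I\<close>, and its trace may be computed in an orthonormal
  basis of the column space of \<open>X\<^sub>S\<close>, so
  \<open>0 \<le> A \<le> rank X\<^sub>S I\<close>.  The bound (iii) follows from \<open>I - D\<^sup>-\<^sup>1 = - (A / n) D\<^sup>-\<^sup>1\<close> with
  \<open>D = I - A / n\<close>.
\<close>

section \<open>Pseudoinverses of symmetric matrices\<close>

lemma inner_symmetric_matrix:
  fixes M :: "real ^ 'm ^ 'm"
  assumes "symmetric_matrix M"
  shows "x \<bullet> (M *v y) = (M *v x) \<bullet> y"
  using assms unfolding symmetric_matrix_def by (metis dot_lmul_matrix vector_transpose_matrix)

text \<open>Since \<open>A ** G\<close> and \<open>A ** G'\<close> are symmetric, transposing
  \<open>A ** G' ** A ** G = A ** G\<close> reverses the two factors, and the reversed product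
  collapses to \<open>A ** G'\<close>. The same argument on the other side gives
  \<open>G ** A = G' ** A\<close>, so
  \<open>G = G ** A ** G = G' ** A ** G = G' ** A ** G' = G'\<close>.\<close>

lemma moore_penrose_unique:
  fixes A :: "real ^ 'k ^ 'm"
  assumes "is_moore_penrose A G" "is_moore_penrose A G'"
  shows "G = G'"
proof -
  note mp = assms[unfolded is_moore_penrose_def]
  have "A ** G = transpose ((A ** G') ** (A ** G))"
    using mp by (metis matrix_mul_assoc)
  also have "\<dots> = (A ** G) ** (A ** G')"
    using mp by (simp add: matrix_transpose_mul)
  also have "\<dots> = A ** G'"
    using mp by (metis matrix_mul_assoc)
  finally have AG: "A ** G = A ** G'" .
  have "G ** A = transpose ((G ** A) ** (G' ** A))"
    using mp by (metis matrix_mul_assoc)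
  also have "\<dots> = (G' ** A) ** (G ** A)"
    using mp by (simp add: matrix_transpose_mul)
  also have "\<dots> = G' ** A"
    using mp by (metis matrix_mul_assoc)
  finally have GA: "G ** A = G' ** A" .
  show ?thesis
    using mp AG GA by (metis matrix_mul_assoc)
qed

lemma moore_penrose_eqI:
  assumes "is_moore_penrose A G"
  shows "moore_penrose A = G"
  unfolding moore_penrose_def using assms moore_penrose_unique by blast

text \<open>The range of a symmetric \<open>M\<close> meets its kernel only in 0, so
  \<open>M\<close> maps its range injectively, hence by dimension onto itself. Every column of
  \<open>M\<close> is therefore an image under \<open>M ** M\<close>. This takes the place of a
  spectral decomposition in building the pseudoinverse.\<close>

lemma symmetric_matrix_factors_through_square:
  fixes M :: "real ^ 'm ^ 'm"
  assumes "symmetric_matrix M"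
  obtains N where "M ** M ** N = M"
proof -
  let ?R = "range (\<lambda>x. M *v x)"
  have sub: "subspace ?R"
    by (intro linear_subspace_image subspace_UNIV) simp
  have "inj_on ((*v) M) (span ?R)"
  proof (subst linear_injective_on_subspace_0)
    show "\<forall>x\<in>span ?R. M *v x = 0 \<longrightarrow> x = 0"
    proof (intro ballI impI)
      fix x assume "x \<in> span ?R" and 0: "M *v x = 0"
      then obtain y where y: "x = M *v y"
        using sub by (auto simp: span_eq_iff[THEN iffD2])
      have "x \<bullet> x = y \<bullet> (M *v x)"
        using inner_symmetric_matrix[OF assms, of y x] y by simp
      then show "x = 0" using 0 by simp
    qed
  qed auto
  then have dim: "dim ((*v) M ` ?R) = dim ?R"
    by (intro dim_image_eq) auto
  have "(*v) M ` ?R = ?R"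
    by (rule subspace_dim_equal) (use dim sub in \<open>auto intro: linear_subspace_image\<close>)
  then have "\<forall>j. \<exists>y. M *v (M *v y) = M *v axis j 1"
    by (metis (no_types, lifting) imageE rangeI)
  then obtain f where f: "\<And>j. M *v (M *v f j) = M *v axis j 1" by metis
  \<comment> \<open>The preimages \<open>f j\<close> become the columns of \<open>N\<close>.\<close>
  have "M ** M ** (\<chi> i j. f j $ i) = M"
  proof -
    have "(M ** M ** (\<chi> i j. f j $ i)) $ i $ j = (M *v (M *v f j)) $ i" for i j
      by (simp only: matrix_vector_mul_assoc)
         (simp add: matrix_matrix_mult_def matrix_vector_mult_def)
    then show ?thesis
      by (simp add: vec_eq_iff f matrix_vector_mult_basis column_def)
  qed
  then show thesis using that by blast
qed

text \<open>The matrix \<open>M ** N\<close> is the orthogonal projection onto the range of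
  \<open>M\<close>. It is symmetric because
  \<open>transpose N ** M = transpose N ** M ** M ** N = M ** N\<close>, and multiplying the
  candidate by \<open>M\<close> on either side yields this projection.\<close>

lemma is_moore_penrose_symmetric_matrix:
  fixes M :: "real ^ 'm ^ 'm"
  assumes sym: "symmetric_matrix M" and N: "M ** M ** N = M"
  shows "is_moore_penrose M (transpose N ** M ** N)"
proof -
  let ?P = "M ** N" and ?G = "transpose N ** M ** N"
  have M: "transpose M = M" using sym by (simp add: symmetric_matrix_def)
  have N': "transpose N ** M ** M = M"
    using arg_cong[OF N, of transpose] M by (simp add: matrix_transpose_mul matrix_mul_assoc)
  have P: "transpose N ** M = ?P"
    using N N' by (metis matrix_mul_assoc)
  have Pt: "transpose ?P = ?P" using M P by (simp add: matrix_transpose_mul)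
  have Gt: "transpose ?G = ?G" using M by (simp add: matrix_transpose_mul matrix_mul_assoc)
  have MG: "M ** ?G = ?P"
    using N P by (metis matrix_mul_assoc)
  have GM: "?G ** M = ?P"
    using arg_cong[OF MG, of transpose] M Gt Pt by (simp add: matrix_transpose_mul)
  have PM: "?P ** M = M" using N' P by simp
  have "?P ** ?P = ?P" using N P by (metis PM matrix_mul_assoc)
  then have PG: "?P ** ?G = ?G" using P by (metis matrix_mul_assoc)
  show ?thesis
    unfolding is_moore_penrose_def MG GM PM PG using Pt by simp
qed

lemma is_moore_penrose_moore_penrose_symmetric:
  fixes M :: "real ^ 'm ^ 'm"
  assumes "symmetric_matrix M"
  shows "is_moore_penrose M (moore_penrose M)"
  by (metis assms symmetric_matrix_factors_through_square
      is_moore_penrose_symmetric_matrix moore_penrose_eqI)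

lemma symmetric_matrix_moore_penrose:
  fixes M :: "real ^ 'm ^ 'm"
  assumes "symmetric_matrix M"
  shows "symmetric_matrix (moore_penrose M)"
proof -
  obtain N where N: "M ** M ** N = M"
    using assms by (rule symmetric_matrix_factors_through_square)
  have "moore_penrose M = transpose N ** M ** N"
    using assms N by (intro moore_penrose_eqI is_moore_penrose_symmetric_matrix)
  then show ?thesis
    using assms by (simp add: symmetric_matrix_def matrix_transpose_mul matrix_mul_assoc)
qed

section \<open>Positive semidefinite matrices and the quadratic form of the pseudoinverse\<close>

lemma positive_semidefinite_add:
  assumes "positive_semidefinite A" "positive_semidefinite B"
  shows "positive_semidefinite (A + B)"
  using assms
  by (auto simp: positive_semidefinite_def symmetric_matrix_def transpose_def vec_eq_iff
      matrix_vector_mult_add_rdistrib inner_add_right)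

lemma positive_semidefinite_scaleR:
  assumes "positive_semidefinite A" "0 \<le> c"
  shows "positive_semidefinite (c *\<^sub>R A)"
  using assms
  by (auto simp: positive_semidefinite_def symmetric_matrix_def transpose_def vec_eq_iff
      scaleR_matrix_vector_assoc[symmetric])

lemma positive_semidefinite_sum:
  assumes "\<And>i. i \<in> I \<Longrightarrow> positive_semidefinite (f i)"
  shows "positive_semidefinite (sum f I)"
  using assms
proof (induction I rule: infinite_finite_induct)
  case (insert i I)
  then show ?case by (simp add: positive_semidefinite_add)
qed (simp_all add: positive_semidefinite_def symmetric_matrix_def transpose_def vec_eq_iff)

lemma inner_transpose_mult:
  fixes W :: "real ^ 'k ^ 'm"
  shows "x \<bullet> (transpose W *v y) = (W *v x) \<bullet> y"
  by (metis dot_lmul_matrix inner_commute vector_transpose_matrix transpose_transpose)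

lemma inner_gram:
  fixes W :: "real ^ 'k ^ 'm"
  shows "x \<bullet> ((transpose W ** W) *v x) = (norm (W *v x))\<^sup>2"
  by (simp add: matrix_vector_mul_assoc[symmetric] inner_transpose_mult power2_norm_eq_inner
      del: transpose_matrix_vector)

lemma positive_semidefinite_gram:
  fixes W :: "real ^ 'k ^ 'm"
  shows "positive_semidefinite (transpose W ** W)"
  by (simp add: positive_semidefinite_def symmetric_matrix_def inner_gram matrix_transpose_mul)

text \<open>Rests on \<open>G = G ** M ** G\<close> with \<open>G\<close> symmetric. It moves the
  form of \<open>G\<close> back to that of \<open>M\<close>, so positivity passes to
  \<open>G\<close> and the summands of \<open>M\<close> can be estimated separately.\<close>

lemma inner_moore_penrose:
  fixes M :: "real ^ 'm ^ 'm"
  assumes "symmetric_matrix M"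
  defines "G \<equiv> moore_penrose M"
  shows "w \<bullet> (G *v w) = (G *v w) \<bullet> (M *v (G *v w))"
proof -
  have "G ** M ** G = G"
    using is_moore_penrose_moore_penrose_symmetric[OF assms(1)]
    by (simp add: is_moore_penrose_def G_def)
  then have "w \<bullet> (G *v w) = w \<bullet> (G *v (M *v (G *v w)))"
    by (metis matrix_vector_mul_assoc)
  also have "\<dots> = (G *v w) \<bullet> (M *v (G *v w))"
    using symmetric_matrix_moore_penrose[OF assms(1)] inner_symmetric_matrix
    unfolding G_def by blast
  finally show ?thesis .
qed

lemma inner_moore_penrose_nonneg:
  assumes "positive_semidefinite M"
  shows "0 \<le> w \<bullet> (moore_penrose M *v w)"
  using assms inner_moore_penrose[of M w] by (simp add: positive_semidefinite_def)

text \<open>The matrix \<open>K = W (W\<^sup>T W + H)\<^sup>\<dagger> W\<^sup>T\<close> satisfies \<open>K\<^sup>2 \<le> K\<close>, hence \<open>K \<le> I\<close>.\<close>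

lemma inner_regularized_projection_le:
  fixes W :: "real ^ 'k ^ 'm"
  assumes H: "positive_semidefinite H"
  shows "(transpose W *v z) \<bullet> (moore_penrose (transpose W ** W + H) *v (transpose W *v z))
    \<le> (norm z)\<^sup>2"
proof -
  define M where "M = transpose W ** W + H"
  define y where "y = moore_penrose M *v (transpose W *v z)"
  have "symmetric_matrix M"
    using positive_semidefinite_add[OF positive_semidefinite_gram[of W] H]
    by (simp add: M_def positive_semidefinite_def)
  then have "(transpose W *v z) \<bullet> y = y \<bullet> (M *v y)"
    unfolding y_def by (rule inner_moore_penrose)
  \<comment> \<open>The Gram part of \<open>M\<close> contributes exactly this square; the part from
    \<open>H\<close> is nonnegative and is dropped.\<close>
  also have "\<dots> \<ge> (norm (W *v y))\<^sup>2"
    using H by (simp add: M_def matrix_vector_mult_add_rdistrib inner_add_right inner_gram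
        positive_semidefinite_def)
  finally have le: "(norm (W *v y))\<^sup>2 \<le> (transpose W *v z) \<bullet> y" .
  have eq: "(transpose W *v z) \<bullet> y = (W *v y) \<bullet> z"
    by (metis inner_commute inner_transpose_mult)
  also have "\<dots> \<le> norm (W *v y) * norm z" by (rule norm_cauchy_schwarz)
  finally have cs: "(transpose W *v z) \<bullet> y \<le> norm (W *v y) * norm z" .
  \<comment> \<open>Chaining \<open>le\<close> with \<open>cs\<close> bounds the square of
    \<open>norm (W *v y)\<close> by its product with \<open>norm z\<close>; one factor cancels
    unless it is zero.\<close>
  have "norm (W *v y) \<le> norm z"
  proof (cases "norm (W *v y) = 0")
    case False
    then show ?thesis using le cs
      by (metis mult_le_cancel_left_pos norm_ge_zero order_le_less order_trans power2_eq_square)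
  qed simp
  then have "norm (W *v y) * norm z \<le> (norm z)\<^sup>2"
    by (simp add: mult_right_mono power2_eq_square)
  then show ?thesis using cs unfolding y_def M_def by simp
qed

section \<open>Traces computed in an orthonormal family\<close>

lemma inner_mult_sum_scaleR:
  fixes G :: "real ^ 'k ^ 'k"
  shows "(\<Sum>b\<in>Q. r b *\<^sub>R g b) \<bullet> (G *v (\<Sum>c\<in>Q. r c *\<^sub>R g c)) =
    (\<Sum>b\<in>Q. \<Sum>c\<in>Q. r b * r c * (g b \<bullet> (G *v g c)))"
  by (subst sum.swap)
     (simp add: linear_sum[OF matrix_vector_mul_linear] inner_sum_left inner_sum_right
       matrix_vector_mult_scaleR sum_distrib_left mult_ac)

text \<open>Basis invariance of the trace, for a family \<open>Q\<close> that may span only a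
  subspace: the last assumption says that \<open>f\<close> depends on \<open>u\<close> only through
  its coordinates along \<open>Q\<close>. Summing over the standard basis turns the coefficient
  products into \<open>b \<bullet> c\<close>, and orthonormality leaves the diagonal.\<close>

lemma sum_basis_eq_sum_orthonormal:
  fixes f :: "real ^ 'n \<Rightarrow> real ^ 'k" and G :: "real ^ 'k ^ 'k"
  assumes fin: "finite Q" and orth: "pairwise orthogonal Q" and unit: "\<And>b. b \<in> Q \<Longrightarrow> norm b = 1"
    and f: "\<And>u. f u = (\<Sum>b\<in>Q. (b \<bullet> u) *\<^sub>R f b)"
  shows "(\<Sum>i\<in>UNIV. f (axis i 1) \<bullet> (G *v f (axis i 1))) = (\<Sum>b\<in>Q. f b \<bullet> (G *v f b))"
proof -
  have ip: "b \<bullet> c = (if c = b then 1 else 0)" if "b \<in> Q" "c \<in> Q" for b c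
    using orth unit that by (auto simp: pairwise_def orthogonal_def dot_square_norm)
  have "f u \<bullet> (G *v f u) = (\<Sum>b\<in>Q. \<Sum>c\<in>Q. (b \<bullet> u) * (c \<bullet> u) * (f b \<bullet> (G *v f c)))" for u
    by (subst (1 2) f) (rule inner_mult_sum_scaleR)
  then have "(\<Sum>i\<in>UNIV. f (axis i 1) \<bullet> (G *v f (axis i 1))) =
      (\<Sum>i\<in>UNIV. \<Sum>b\<in>Q. \<Sum>c\<in>Q. b $ i * c $ i * (f b \<bullet> (G *v f c)))"
    by (simp add: inner_axis)
  also have "\<dots> = (\<Sum>b\<in>Q. \<Sum>c\<in>Q. \<Sum>i\<in>UNIV. b $ i * c $ i * (f b \<bullet> (G *v f c)))"
    by (subst sum.swap, subst (2) sum.swap, simp)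
  also have "\<dots> = (\<Sum>b\<in>Q. \<Sum>c\<in>Q. (b \<bullet> c) * (f b \<bullet> (G *v f c)))"
    by (simp add: inner_vec_def sum_distrib_right)
  also have "\<dots> = (\<Sum>b\<in>Q. f b \<bullet> (G *v f b))"
    using fin by (intro sum.cong refl) (simp add: ip sum.delta if_distrib[of "\<lambda>x. x * _"] cong: if_cong)
  finally show ?thesis .
qed

section \<open>Kronecker products and positivity of the regularizing term\<close>

definition vkron :: "real ^ 'a \<Rightarrow> real ^ 'b \<Rightarrow> real ^ ('a \<times> 'b)" where
  "vkron v u = (\<chi> i. v $ fst i * u $ snd i)"

lemma sum_UNIV_prod:
  "(\<Sum>i\<in>UNIV. g i) = (\<Sum>a\<in>UNIV. \<Sum>b\<in>UNIV. g (a, b))"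
  by (simp add: sum.cartesian_product)

lemma linear_vkron: "linear (vkron v)"
  by (rule linearI) (simp_all add: vkron_def vec_eq_iff algebra_simps)

lemma norm_vkron: "norm (vkron v u) = norm v * norm u"
  by (simp add: norm_eq_sqrt_inner inner_vec_def vkron_def sum_UNIV_prod sum_product
      real_sqrt_mult[symmetric] algebra_simps)

lemma kron_mult_vkron: "(P \<otimes>\<^sub>K Q) *v vkron v u = vkron (P *v v) (Q *v u)"
  by (simp add: vec_eq_iff kron_def vkron_def matrix_vector_mult_def sum_UNIV_prod sum_product
      algebra_simps)

lemma transpose_kron: "transpose (P \<otimes>\<^sub>K Q) = transpose P \<otimes>\<^sub>K transpose Q"
  by (simp add: vec_eq_iff kron_def transpose_def)

lemma outer_axis_nth: "outer (axis j 1) (axis j 1) $ k $ l = of_bool (k = j) * of_bool (l = j)"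
  by (simp add: outer_def matrix_matrix_mult_def columnvector_def rowvector_def axis_def)

text \<open>For nonzero \<open>b\<close>, the \<open>j\<close>-th row of \<open>B\<close>, this is
  the Hessian of \<open>lam\<close> times the Euclidean norm at \<open>b\<close>: a nonnegative
  multiple of the orthogonal projection onto the complement of \<open>b\<close>. Positivity is
  Cauchy-Schwarz.\<close>

lemma positive_semidefinite_H_row:
  assumes "0 \<le> lam"
  shows "positive_semidefinite (H_row lam B j)"
proof -
  define b where "b = transpose B *v axis j 1"
  have b: "b $ t = B $ j $ t" for t
    by (simp add: b_def matrix_vector_mult_basis column_def transpose_def)
  have "(transpose B ** outer (axis j 1) (axis j 1)) $ s $ k = of_bool (k = j) * B $ j $ s" for s k
    by (simp add: matrix_matrix_mult_def outer_axis_nth transpose_def of_bool_def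
        if_distrib[of "\<lambda>x. _ * x"] cong: if_cong)
  then have bb: "transpose B ** outer (axis j 1) (axis j 1) ** B = (\<chi> s t. b $ s * b $ t)"
    by (simp add: vec_eq_iff matrix_matrix_mult_def[of _ B] b of_bool_def
        if_distrib[of "\<lambda>x. x * _"] cong: if_cong)
  have mv: "(\<chi> s t. b $ s * b $ t) *v v = (b \<bullet> v) *\<^sub>R b" for v
    by (simp add: vec_eq_iff matrix_vector_mult_def inner_vec_def sum_distrib_left
        sum_distrib_right algebra_simps)
  have "positive_semidefinite (mat 1 - inverse ((norm b)\<^sup>2) *\<^sub>R (\<chi> s t. b $ s * b $ t))"
    unfolding positive_semidefinite_def
  proof (intro conjI allI)
    show "symmetric_matrix (mat 1 - inverse ((norm b)\<^sup>2) *\<^sub>R (\<chi> s t. b $ s * b $ t))"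
      by (auto simp: symmetric_matrix_def vec_eq_iff transpose_def mat_def)
    fix v
    have "(b \<bullet> v)\<^sup>2 \<le> (norm b)\<^sup>2 * (norm v)\<^sup>2"
      using Cauchy_Schwarz_ineq[of b v] by (simp add: power2_norm_eq_inner)
    then have "inverse ((norm b)\<^sup>2) * ((b \<bullet> v) * (b \<bullet> v)) \<le> v \<bullet> v"
      by (cases "b = 0") (simp_all add: field_simps power2_eq_square[of "b \<bullet> v"] dot_square_norm)
    then show "0 \<le> v \<bullet> ((mat 1 - inverse ((norm b)\<^sup>2) *\<^sub>R (\<chi> s t. b $ s * b $ t)) *v v)"
      by (simp add: matrix_vector_mult_diff_rdistrib scaleR_matrix_vector_assoc[symmetric] mv
          inner_diff_right inner_commute mult.assoc)
  qed
  then show ?thesis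
    unfolding H_row_def b_def[symmetric] bb
    using assms by (intro positive_semidefinite_scaleR) auto
qed

text \<open>The right factor keeps only the entries of \<open>z\<close> whose second index is
  \<open>j\<close>, so the form reduces to that of \<open>P\<close> at this slice
  \<open>y\<close>.\<close>

lemma positive_semidefinite_kron_outer_axis:
  fixes P :: "real ^ 't ^ 't" and j :: "'a::finite"
  assumes "positive_semidefinite P"
  shows "positive_semidefinite (P \<otimes>\<^sub>K outer (axis j 1) (axis j 1))"
  unfolding positive_semidefinite_def
proof (intro conjI allI)
  show "symmetric_matrix (P \<otimes>\<^sub>K outer (axis j 1) (axis j 1))"
    using assms by (simp add: positive_semidefinite_def symmetric_matrix_def vec_eq_iff
        transpose_def kron_def outer_axis_nth)
  fix z :: "real ^ ('t \<times> 'a)"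
  define y where "y = (\<chi> t. z $ (t, j))"
  have "((P \<otimes>\<^sub>K outer (axis j 1) (axis j 1)) *v z) $ (s, k) = of_bool (k = j) * (P *v y) $ s"
    for s k
    by (simp add: matrix_vector_mult_def kron_def outer_axis_nth sum_UNIV_prod y_def of_bool_def
        if_distrib[of "\<lambda>x. x * _"] if_distrib[of "\<lambda>x. _ * x"] cong: if_cong)
  then have "z \<bullet> ((P \<otimes>\<^sub>K outer (axis j 1) (axis j 1)) *v z) = y \<bullet> (P *v y)"
    by (simp add: inner_vec_def sum_UNIV_prod y_def of_bool_def if_distrib[of "\<lambda>x. x * _"]
        if_distrib[of "\<lambda>x. _ * x"] cong: if_cong)
  then show "0 \<le> z \<bullet> ((P \<otimes>\<^sub>K outer (axis j 1) (axis j 1)) *v z)"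
    using assms by (simp add: positive_semidefinite_def)
qed

lemma positive_semidefinite_H_tilde:
  assumes "0 \<le> lam"
  shows "positive_semidefinite (H_tilde lam B)"
  unfolding H_tilde_def
  by (intro positive_semidefinite_sum positive_semidefinite_kron_outer_axis
      positive_semidefinite_H_row assms)

section \<open>The quadratic form of the interaction matrix\<close>

lemma trace_mult_mult:
  fixes P :: "real ^ 'k ^ 'm"
  shows "trace (P ** G ** Q) = (\<Sum>i\<in>UNIV. P $ i \<bullet> (G *v column i Q))"
  unfolding matrix_mul_assoc[symmetric]
  by (simp add: trace_def matrix_matrix_mult_def inner_vec_def matrix_vector_mult_def column_def)

locale interaction =
  fixes X :: "real ^ 'p ^ 'n" and lam :: real and B :: "real ^ 't ^ 'p"
  assumes lam_nonneg: "0 \<le> lam"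
begin

definition XS :: "real ^ 'p ^ 'n" where
  "XS = restrict_columns X (row_support B)"

definition M :: "real ^ ('t \<times> 'p) ^ ('t \<times> 'p)" where
  "M = transpose (X_tilde X B) ** X_tilde X B + (real CARD('n) * real CARD('t)) *\<^sub>R H_tilde lam B"

abbreviation G :: "real ^ ('t \<times> 'p) ^ ('t \<times> 'p)" where
  "G \<equiv> moore_penrose M"

abbreviation A :: "real ^ 't ^ 't" where
  "A \<equiv> interaction_matrix X lam B"

lemma positive_semidefinite_scaled_H:
  "positive_semidefinite ((real CARD('n) * real CARD('t)) *\<^sub>R H_tilde lam B)"
  using lam_nonneg by (intro positive_semidefinite_scaleR positive_semidefinite_H_tilde) auto

lemma positive_semidefinite_M: "positive_semidefinite M"
  unfolding M_def
  by (intro positive_semidefinite_add positive_semidefinite_gram positive_semidefinite_scaled_H)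

text \<open>Row \<open>i\<close> of the left Kronecker factor and column \<open>i\<close> of the
  right one are both Kronecker products of an axis vector with row \<open>i\<close> of
  \<open>XS\<close>, so the trace is a sum over the rows of \<open>XS\<close>.\<close>

lemma interaction_matrix_nth:
  "A $ s $ t = (\<Sum>i\<in>UNIV. vkron (axis s 1) (XS $ i) \<bullet> (G *v vkron (axis t 1) (XS $ i)))"
proof -
  have row: "((rowvector (axis s 1) :: real ^ 't ^ 1) \<otimes>\<^sub>K XS) $ (a, i) = vkron (axis s 1) (XS $ i)"
    for a s i by (simp add: vec_eq_iff kron_def vkron_def rowvector_def)
  have col: "column (a, i) ((columnvector (axis t 1) :: real ^ 1 ^ 't) \<otimes>\<^sub>K transpose XS)
      = vkron (axis t 1) (XS $ i)"
    for a i by (simp add: vec_eq_iff kron_def vkron_def columnvector_def column_def transpose_def)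
  show ?thesis
    unfolding interaction_matrix_def Let_def XS_def[symmetric] M_def[symmetric]
    by (simp add: trace_mult_mult sum_UNIV_prod row col)
qed

lemma symmetric_interaction_matrix: "symmetric_matrix A"
proof -
  have "symmetric_matrix G"
    using positive_semidefinite_M symmetric_matrix_moore_penrose
    by (auto simp: positive_semidefinite_def)
  then have "x \<bullet> (G *v y) = y \<bullet> (G *v x)" for x y
    by (metis inner_symmetric_matrix inner_commute)
  then show ?thesis
    by (simp add: symmetric_matrix_def transpose_def vec_eq_iff interaction_matrix_nth)
qed

text \<open>Expanding \<open>v\<close> in the axis vectors and using bilinearity of the form of
  \<open>G\<close> gives back the entries of \<open>A\<close>.\<close>

lemma inner_interaction_matrix:
  "v \<bullet> (A *v v) = (\<Sum>i\<in>UNIV. vkron v (XS $ i) \<bullet> (G *v vkron v (XS $ i)))"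
proof -
  have v: "vkron v u = (\<Sum>s\<in>UNIV. v $ s *\<^sub>R vkron (axis s 1) u)" for u :: "real ^ 'p"
    by (simp add: vec_eq_iff vkron_def axis_def if_distrib[of "\<lambda>x. x * _"]
        if_distrib[of "\<lambda>x. _ * x"] cong: if_cong)
  have "vkron v u \<bullet> (G *v vkron v u) = (\<Sum>s\<in>UNIV. \<Sum>t\<in>UNIV.
      v $ s * v $ t * (vkron (axis s 1) u \<bullet> (G *v vkron (axis t 1) u)))" for u
    by (subst (1 2) v) (rule inner_mult_sum_scaleR)
  then have "(\<Sum>i\<in>UNIV. vkron v (XS $ i) \<bullet> (G *v vkron v (XS $ i))) =
    (\<Sum>i\<in>UNIV. \<Sum>s\<in>UNIV. \<Sum>t\<in>UNIV. v $ s * v $ t *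
      (vkron (axis s 1) (XS $ i) \<bullet> (G *v vkron (axis t 1) (XS $ i))))"
    by simp
  also have "\<dots> = (\<Sum>s\<in>UNIV. \<Sum>t\<in>UNIV. \<Sum>i\<in>UNIV. v $ s * v $ t *
      (vkron (axis s 1) (XS $ i) \<bullet> (G *v vkron (axis t 1) (XS $ i))))"
    by (subst sum.swap, subst (2) sum.swap, simp)
  also have "\<dots> = v \<bullet> (A *v v)"
    by (simp add: inner_vec_def matrix_vector_mult_def interaction_matrix_nth sum_distrib_left
        sum_distrib_right mult_ac)
  finally show ?thesis ..
qed

lemma positive_semidefinite_interaction_matrix: "positive_semidefinite A"
  unfolding positive_semidefinite_def
  by (auto simp: symmetric_interaction_matrix inner_interaction_matrix
      intro!: sum_nonneg inner_moore_penrose_nonneg positive_semidefinite_M)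

text \<open>Bounding the sum over the rows of \<open>XS\<close> term by term would give the factor
  \<open>n\<close>. Summing instead over an orthonormal basis \<open>Q\<close> of the column space
  leaves only \<open>rank XS\<close> terms, each at most the squared norm of
  \<open>v\<close>.\<close>

lemma inner_interaction_matrix_le: "v \<bullet> (A *v v) \<le> real (rank XS) * (norm v)\<^sup>2"
proof -
  let ?R = "range (\<lambda>x. XS *v x)"
  have sub: "subspace ?R"
    by (intro linear_subspace_image subspace_UNIV) simp
  obtain Q where Q: "Q \<subseteq> ?R" "pairwise orthogonal Q" "\<And>b. b \<in> Q \<Longrightarrow> norm b = 1"
      "independent Q" "card Q = dim ?R" "span Q = ?R"
    using orthonormal_basis_subspace[OF sub] by metis
  have fin: "finite Q" using Q(4) by (rule finiteI_independent)
  define f where "f u = vkron v (transpose XS *v u)" for u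
  have lin: "linear f"
    unfolding f_def using linear_compose[OF matrix_vector_mul_linear linear_vkron]
    by (simp add: o_def del: transpose_matrix_vector)
  have kill: "f u = 0" if "\<And>x. x \<in> ?R \<Longrightarrow> orthogonal x u" for u
  proof -
    have "x \<bullet> (transpose XS *v u) = 0" for x
      using that[of "XS *v x"] by (simp add: inner_transpose_mult orthogonal_def del: transpose_matrix_vector)
    then have "transpose XS *v u = 0" by (metis inner_eq_zero_iff)
    then show ?thesis by (simp add: f_def linear_0[OF linear_vkron])
  qed
  \<comment> \<open>Subtracting from \<open>u\<close> its projection onto the span of
    \<open>Q\<close> leaves a vector orthogonal to the column space, which \<open>f\<close> sends to
    0.\<close>
  have exp: "f u = (\<Sum>b\<in>Q. (b \<bullet> u) *\<^sub>R f b)" for u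
  proof -
    have "f (u - (\<Sum>b\<in>Q. (b \<bullet> u / (b \<bullet> b)) *\<^sub>R b)) = 0"
      using Q(2,6) by (intro kill Gram_Schmidt_step) auto
    moreover have "(\<Sum>b\<in>Q. (b \<bullet> u / (b \<bullet> b)) *\<^sub>R b) = (\<Sum>b\<in>Q. (b \<bullet> u) *\<^sub>R b)"
      using Q(3) by (intro sum.cong) (auto simp: dot_square_norm)
    ultimately show ?thesis
      by (simp add: linear_diff[OF lin] linear_sum[OF lin] linear_scale[OF lin])
  qed
  have ax: "f (axis i 1) = vkron v (XS $ i)" for i
    by (simp add: f_def matrix_vector_mult_basis column_def transpose_def)
  have "v \<bullet> (A *v v) = (\<Sum>b\<in>Q. f b \<bullet> (G *v f b))"
    using sum_basis_eq_sum_orthonormal[OF fin Q(2,3) exp, of G]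
    by (simp add: ax inner_interaction_matrix)
  also have "\<dots> \<le> (\<Sum>b\<in>Q. (norm v)\<^sup>2)"
  proof (rule sum_mono)
    fix b assume "b \<in> Q"
    \<comment> \<open>This puts \<open>f b\<close> in the form required by the bound for the
      regularized projection, with \<open>z = vkron v b\<close>.\<close>
    have "f b = transpose (X_tilde X B) *v vkron v b"
      by (simp add: X_tilde_def transpose_kron kron_mult_vkron f_def XS_def transpose_mat)
    then have "f b \<bullet> (G *v f b) \<le> (norm (vkron v b))\<^sup>2"
      unfolding M_def
      using inner_regularized_projection_le[OF positive_semidefinite_scaled_H] by metis
    then show "f b \<bullet> (G *v f b) \<le> (norm v)\<^sup>2"
      using Q(3)[OF \<open>b \<in> Q\<close>] by (simp add: norm_vkron)
  qed
  also have "\<dots> = real (rank XS) * (norm v)\<^sup>2"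
    using Q(5) by (simp add: rank_dim_range)
  finally show ?thesis .
qed

end

section \<open>From bounds on quadratic forms to operator norms\<close>

lemma positive_semidefinite_norm_mult_le:
  fixes A :: "real ^ 'm ^ 'm"
  assumes psd: "positive_semidefinite A" and le: "\<And>v. v \<bullet> (A *v v) \<le> c * (norm v)\<^sup>2"
    and c: "0 < c"
  shows "norm (A *v v) \<le> c * norm v"
proof -
  define u where "u = A *v v"
  have sym: "v \<bullet> (A *v u) = u \<bullet> u"
    using psd inner_symmetric_matrix unfolding u_def positive_semidefinite_def by blast
  \<comment> \<open>This test vector is \<open>(c I - A) v\<close>. Expanding and using the upper
    bound at \<open>u\<close> yields \<open>u \<bullet> u \<le> c * (v \<bullet> u)\<close>, that
    is, \<open>A ** A\<close> is at most \<open>c A\<close>.\<close>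
  have "0 \<le> (c *\<^sub>R v - u) \<bullet> (A *v (c *\<^sub>R v - u))"
    using psd by (simp add: positive_semidefinite_def)
  also have "\<dots> = c * c * (v \<bullet> u) - 2 * c * (u \<bullet> u) + u \<bullet> (A *v u)"
    by (simp add: matrix_vector_mult_diff_distrib matrix_vector_mult_scaleR inner_diff_left
        inner_diff_right u_def[symmetric] sym algebra_simps)
  also have "\<dots> \<le> c * c * (v \<bullet> u) - c * (u \<bullet> u)"
    using le[of u] by (simp add: power2_norm_eq_inner)
  finally have "c * (u \<bullet> u) \<le> c * (c * (v \<bullet> u))" by (simp add: mult.assoc)
  then have "u \<bullet> u \<le> c * (v \<bullet> u)" using c by simp
  also have "\<dots> \<le> c * (norm v * norm u)"
    using c by (intro mult_left_mono norm_cauchy_schwarz) auto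
  finally have "norm u * norm u \<le> (c * norm v) * norm u"
    by (simp add: dot_square_norm power2_eq_square mult.assoc)
  then show ?thesis
    using c by (cases "norm u = 0") (auto simp: u_def)
qed

lemma positive_semidefinite_op_norm_le:
  fixes A :: "real ^ 'm ^ 'm"
  assumes psd: "positive_semidefinite A" and le: "\<And>v. v \<bullet> (A *v v) \<le> c * (norm v)\<^sup>2"
    and c: "0 \<le> c"
  shows "op_norm A \<le> c"
\<comment> \<open>The preceding estimate divides by a positive constant, so it is applied to every
  \<open>d > c\<close>, which covers \<open>c = 0\<close>.\<close>
proof (rule dense_ge)
  fix d assume d: "c < d"
  have "norm (A *v v) \<le> d * norm v" for v
  proof (rule positive_semidefinite_norm_mult_le[OF psd])
    show "w \<bullet> (A *v w) \<le> d * (norm w)\<^sup>2" for w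
      using le[of w] d by (meson less_imp_le mult_right_mono order_trans zero_le_power2)
  qed (use c d in simp)
  then show "op_norm A \<le> d"
    unfolding op_norm_def by (rule onorm_le)
qed

lemma norm_mult_le_op_norm: "norm (A *v v) \<le> op_norm A * norm v"
  unfolding op_norm_def by (intro onorm) (simp add: linear_linear)

text \<open>The reverse triangle inequality makes \<open>mat 1 - A\<close> expand norms by at least
  the factor \<open>1 - c\<close>. This gives both its invertibility and the bound
  \<open>1 / (1 - c)\<close> for the inverse.\<close>

lemma op_norm_one_minus_inverse_le:
  fixes A :: "real ^ 'm ^ 'm"
  assumes A: "op_norm A \<le> c" and c: "c < 1"
  shows "op_norm (mat 1 - matrix_inv (mat 1 - A)) \<le> c / (1 - c)"
proof -
  let ?D = "mat 1 - A"
  have Av: "norm (A *v v) \<le> c * norm v" for v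
    using norm_mult_le_op_norm[of A v] A by (meson mult_right_mono norm_ge_zero order_trans)
  have D: "(1 - c) * norm v \<le> norm (?D *v v)" for v
    using Av[of v] norm_triangle_ineq2[of v "A *v v"]
    by (simp add: matrix_vector_mult_diff_rdistrib algebra_simps)
  have "v = 0" if "?D *v v = 0" for v
    using D[of v] that c by (simp add: mult_le_0_iff)
  then obtain E where "E ** ?D = mat 1"
    using matrix_left_invertible_ker by blast
  \<comment> \<open>For square matrices a left inverse is two-sided, so the choice inside
    \<open>matrix_inv\<close> has a witness.\<close>
  then have inv: "?D ** matrix_inv ?D = mat 1"
    unfolding matrix_inv_def
    by (metis (mono_tags, lifting) matrix_left_right_inverse someI_ex)
  have "norm ((mat 1 - matrix_inv ?D) *v w) \<le> c / (1 - c) * norm w" for w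
  proof -
    define u where "u = matrix_inv ?D *v w"
    have w: "w = ?D *v u"
      using inv by (simp add: u_def matrix_vector_mul_assoc)
    have "(mat 1 - matrix_inv ?D) *v w = - (A *v u)"
      unfolding matrix_vector_mult_diff_rdistrib u_def[symmetric]
      by (simp add: w matrix_vector_mult_diff_rdistrib)
    then have "norm ((mat 1 - matrix_inv ?D) *v w) \<le> c * norm u"
      using Av[of u] by simp
    also have "\<dots> \<le> c * (norm w / (1 - c))"
    proof (rule mult_left_mono)
      show "norm u \<le> norm w / (1 - c)"
        using D[of u] c w by (simp add: field_simps)
      have "0 \<le> op_norm A"
        unfolding op_norm_def by (intro onorm_pos_le) (simp add: linear_linear)
      then show "0 \<le> c" using A by simp
    qed
    finally show ?thesis by simp
  qed
  then show ?thesis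
    unfolding op_norm_def by (rule onorm_le)
qed

theorem proposition2p1:
  fixes X :: "real ^ 'p ^ 'n" and Y :: "real ^ 't ^ 'n" and lam :: real
    and B :: "real ^ 't ^ 'p" and S :: "'p set" and A :: "real ^ 't ^ 't"
  assumes "lam > 0"
    and "is_mtl_estimator X Y lam B"
    and "S = row_support B"
    and "A = interaction_matrix X lam B"
  shows "(symmetric_matrix A \<and> positive_semidefinite A) \<and>
    (rank (restrict_columns X S) = card S \<longrightarrow> op_norm A \<le> real (card S)) \<and>
    (rank (restrict_columns X S) = card S \<and> real (card S) / real CARD('n) < 1 \<longrightarrow>
      positive_definite (mat 1 - (1 / real CARD('n)) *\<^sub>R A) \<and>
      op_norm (mat 1 - matrix_inv (mat 1 - (1 / real CARD('n)) *\<^sub>R A))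
        \<le> (real (card S) / real CARD('n)) / (1 - real (card S) / real CARD('n)))"
proof (intro conjI impI)
  interpret interaction X lam B
    using assms(1) by unfold_locales simp
  let ?n = "real CARD('n)"
  let ?c = "real (card S) / ?n"
  show sym: "symmetric_matrix A"
    using symmetric_interaction_matrix assms(4) by simp
  show psd: "positive_semidefinite A"
    using positive_semidefinite_interaction_matrix assms(4) by simp
  \<comment> \<open>The rank assumption enters here, replacing the rank in the general bound by
    \<open>card S\<close>.\<close>
  have le: "v \<bullet> (A *v v) \<le> real (card S) * (norm v)\<^sup>2"
    if "rank (restrict_columns X S) = card S" for v
    using inner_interaction_matrix_le[of v] that assms(3,4) by (simp add: XS_def)
  show "op_norm A \<le> real (card S)" if "rank (restrict_columns X S) = card S"
    using psd le[OF that] by (intro positive_semidefinite_op_norm_le) auto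
  assume h: "rank (restrict_columns X S) = card S \<and> ?c < 1"
  have psd': "positive_semidefinite ((1 / ?n) *\<^sub>R A)"
    using psd by (intro positive_semidefinite_scaleR) auto
  \<comment> \<open>With \<open>?c < 1\<close> this one bound yields both positive definiteness and,
    through the operator norm, the estimate for the inverse.\<close>
  have le': "v \<bullet> (((1 / ?n) *\<^sub>R A) *v v) \<le> ?c * (norm v)\<^sup>2" for v
    using le[of v] h by (simp add: scaleR_matrix_vector_assoc[symmetric] divide_right_mono)
  show "positive_definite (mat 1 - (1 / ?n) *\<^sub>R A)"
    unfolding positive_definite_def
  proof (intro conjI allI impI)
    show "symmetric_matrix (mat 1 - (1 / ?n) *\<^sub>R A)"
      using sym by (auto simp: symmetric_matrix_def vec_eq_iff transpose_def mat_def)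
    fix v :: "real ^ 't" assume "v \<noteq> 0"
    then have "?c * (norm v)\<^sup>2 < 1 * (norm v)\<^sup>2"
      using h by (intro mult_strict_right_mono) auto
    then show "0 < v \<bullet> ((mat 1 - (1 / ?n) *\<^sub>R A) *v v)"
      using le'[of v]
      by (simp only: matrix_vector_mult_diff_rdistrib inner_diff_right matrix_vector_mul_lid
          power2_norm_eq_inner)
  qed
  show "op_norm (mat 1 - matrix_inv (mat 1 - (1 / ?n) *\<^sub>R A)) \<le> ?c / (1 - ?c)"
    using h psd' le' by (intro op_norm_one_minus_inverse_le positive_semidefinite_op_norm_le) auto
qed

end
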